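(* Let $\mathbb X_j=(X_j,\{e_i\},\{\gamma_i\},\{\varepsilon_i\})$ ($j=1,2$) be $\mathfrak g$-geometric crystals, with $\mathbb X_1$ prehomogeneous, and let $\Omega_1\subset X_1$ be an open dense orbit in $X_1$. Let $\phi,\phi'\colon\mathbb X_1\to\mathbb X_2$ be isomorphisms of geometric crystals and suppose that there exists $p_1\in\Omega_1$ such that $\phi(p_1)=\phi'(p_1)\in X_2$. Then $\phi=\phi'$ as rational maps.
   Context: $\mathfrak g$ is a Kac–Moody Lie algebra with symmetrizable generalized Cartan matrix $(a_{ij})_{i,j\in I}$, $a_{ij}=\alpha_j(\alpha_i^\vee)$, $I$ finite. **Geometric crystal.** A $\mathfrak g$-geometric crystal is a quadruple $(X,\{e_i\}_{i\in I},\{\gamma_i\}_{i\in I},\{\varepsilon_i\}_{i\in I})$ where $X$ is a complex algebraic variety, each $e_i\colon\mathbb C^\times\times X\to X$, $(c,x)\mapsto e_i^c(x)$, is a rational $\mathbb C^\times$-action, and $\gamma_i,\varepsilon_i\colon X\to\mathbb C$ are rational functions such that (i) $(\{1\}\times X)\cap \mathrm{dom}(e_i)$ is open dense in $\{1\}\times X$; (ii) $\gamma_j(e_i^c(x))=c^{a_{ij}}\gamma_j(x)$; (iii) (Verma relations) $e_i^{c_1}e_j^{c_2}=e_j^{c_2}e_i^{c_1}$ if $a_{ij}=a_{ji}=0$; $e_i^{c_1}e_j^{c_1c_2}e_i^{c_2}=e_j^{c_2}e_i^{c_1c_2}e_j^{c_1}$ if $a_{ij}=a_{ji}=-1$; $e_i^{c_1}e_j^{c_1^2c_2}e_i^{c_1c_2}e_j^{c_2}=e_j^{c_2}e_i^{c_1c_2}e_j^{c_1^2c_2}e_i^{c_1}$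 if $a_{ij}=-2,a_{ji}=-1$; $e_i^{c_1}e_j^{c_1^3c_2}e_i^{c_1^2c_2}e_j^{c_1^3c_2^2}e_i^{c_1c_2}e_j^{c_2}=e_j^{c_2}e_i^{c_1c_2}e_j^{c_1^3c_2^2}e_i^{c_1^2c_2}e_j^{c_1^3c_2}e_i^{c_1}$ if $a_{ij}=-3,a_{ji}=-1$; (iv) $\varepsilon_i(e_i^c(x))=c^{-1}\varepsilon_i(x)$. An isomorphism of geometric crystals is a birational map commuting with all $e_i^c$ and preserving all $\gamma_i$ and $\varepsilon_i$. $\mathbb X$ is prehomogeneous if there is a Zariski open dense subset $\Omega\subset X$ which is an orbit under the actions of the $e_i^c$ ($i\in I$, $c\in\mathbb C^\times$).
   Formalization: The equality φ(p_1)=φ'(p_1) is assumed at a point p_1 where both φ and φ' are local isomorphisms (not merely defined); if they are only regular at p_1 the claim fails. *)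

theory Defs
  imports "HOL-Analysis.Analysis" "HOL-Computational_Algebra.Polynomial"
begin

section \<open>Complex algebraic varieties\<close>

text \<open>
  Varieties are taken in Serre's sense: a topological space together with a sheaf of
  complex-valued functions which is locally isomorphic to an affine variety. The functions
  regular on \<open>U\<close> are HOL functions on the whole type of which only the values on \<open>U\<close> matter;
  \<open>regular X U\<close> is meaningful for open \<open>U\<close> only.
\<close>

record 'a fspace =
  ztop :: "'a topology"
  regular :: "'a set \<Rightarrow> ('a \<Rightarrow> complex) set"

abbreviation points :: "('a, 'z) fspace_scheme \<Rightarrow> 'a set" where
  "points X \<equiv> topspace (ztop X)"

definition function_sheaf :: "'a fspace \<Rightarrow> bool" where
  "function_sheaf X \<longleftrightarrow>
     (\<forall>U. openin (ztop X) U \<longrightarrow>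
        (\<forall>a. (\<lambda>_. a) \<in> regular X U) \<and>
        (\<forall>f\<in>regular X U. \<forall>g\<in>regular X U.
            (\<lambda>x. f x + g x) \<in> regular X U \<and> (\<lambda>x. f x * g x) \<in> regular X U) \<and>
        (\<forall>f\<in>regular X U. \<forall>g. (\<forall>x\<in>U. g x = f x) \<longrightarrow> g \<in> regular X U) \<and>
        (\<forall>f\<in>regular X U. \<forall>V. openin (ztop X) V \<and> V \<subseteq> U \<longrightarrow> f \<in> regular X V) \<and>
        (\<forall>f. (\<forall>x\<in>U. \<exists>V. openin (ztop X) V \<and> x \<in> V \<and> V \<subseteq> U \<and> f \<in> regular X V)
              \<longrightarrow> f \<in> regular X U))"

definition open_subspace :: "'a fspace \<Rightarrow> 'a set \<Rightarrow> 'a fspace" where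
  "open_subspace X U = \<lparr>ztop = subtopology (ztop X) U, regular = regular X\<rparr>"

definition morphism :: "'a fspace \<Rightarrow> 'b fspace \<Rightarrow> ('a \<Rightarrow> 'b) \<Rightarrow> bool" where
  "morphism X Y f \<longleftrightarrow>
     continuous_map (ztop X) (ztop Y) f \<and>
     (\<forall>V. openin (ztop Y) V \<longrightarrow>
        (\<forall>g\<in>regular Y V. g \<circ> f \<in> regular X (points X \<inter> f -` V)))"

definition isomorphic_spaces :: "'a fspace \<Rightarrow> 'b fspace \<Rightarrow> bool" where
  "isomorphic_spaces X Y \<longleftrightarrow>
     (\<exists>f g. morphism X Y f \<and> morphism Y X g \<and>
        (\<forall>x\<in>points X. g (f x) = x) \<and> (\<forall>y\<in>points Y. f (g y) = y))"

text \<open>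
  The Zariski topology on \<open>Z\<close> cut out by a ring \<open>P\<close> of functions, with the functions that are
  locally quotients of elements of \<open>P\<close>.
\<close>

definition quotient_space :: "'a set \<Rightarrow> ('a \<Rightarrow> complex) set \<Rightarrow> 'a fspace" where
  "quotient_space Z P =
     (let T = topology_generated_by {{x \<in> Z. p x \<noteq> 0} | p. p \<in> P} in
      \<lparr>ztop = T,
       regular = (\<lambda>U. {f. \<forall>x\<in>U. \<exists>N. openin T N \<and> x \<in> N \<and> N \<subseteq> U \<and>
                     (\<exists>p\<in>P. \<exists>q\<in>P. \<forall>y\<in>N. q y \<noteq> 0 \<and> f y = p y / q y)})\<rparr>)"

text \<open>Affine \<open>n\<close>-space consists of the sequences that vanish from index \<open>n\<close> on.\<close>

inductive_set poly_functions :: "nat \<Rightarrow> ((nat \<Rightarrow> complex) \<Rightarrow> complex) set" for n :: nat where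
  const: "(\<lambda>_. a) \<in> poly_functions n"
| coord: "i < n \<Longrightarrow> (\<lambda>x. x i) \<in> poly_functions n"
| add: "p \<in> poly_functions n \<Longrightarrow> q \<in> poly_functions n \<Longrightarrow> (\<lambda>x. p x + q x) \<in> poly_functions n"
| mult: "p \<in> poly_functions n \<Longrightarrow> q \<in> poly_functions n \<Longrightarrow> (\<lambda>x. p x * q x) \<in> poly_functions n"

definition zero_locus :: "nat \<Rightarrow> ((nat \<Rightarrow> complex) \<Rightarrow> complex) set \<Rightarrow> (nat \<Rightarrow> complex) set" where
  "zero_locus n S = {x. (\<forall>i\<ge>n. x i = 0) \<and> (\<forall>p\<in>S. p x = 0)}"

definition affine_variety :: "'a fspace \<Rightarrow> bool" where
  "affine_variety X \<longleftrightarrow>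
     (\<exists>n S. S \<subseteq> poly_functions n \<and>
        isomorphic_spaces X (quotient_space (zero_locus n S) (poly_functions n)))"

definition affine_line :: "complex fspace" where
  "affine_line = quotient_space UNIV (range poly)"

definition mult_group :: "complex fspace" where
  "mult_group = quotient_space (UNIV - {0}) (range poly)"

text \<open>
  The product of varieties: over a product \<open>U \<times> V\<close> of open sets take the functions
  \<open>\<Sum>k<n. f\<^sub>k(x) g\<^sub>k(y)\<close>; their non-vanishing loci generate the topology (which is finer than the
  product topology), and regular functions are locally quotients of such functions.
\<close>

definition tensor_functions ::
  "'a fspace \<Rightarrow> 'b fspace \<Rightarrow> 'a set \<Rightarrow> 'b set \<Rightarrow> ('a \<times> 'b \<Rightarrow> complex) set" where
  "tensor_functions X Y U V =
     {(\<lambda>(x, y). \<Sum>k<n. f k x * g k y) | (n::nat) f g.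
        (\<forall>k<n. f k \<in> regular X U \<and> g k \<in> regular Y V)}"

definition prod_space :: "'a fspace \<Rightarrow> 'b fspace \<Rightarrow> ('a \<times> 'b) fspace" where
  "prod_space X Y =
     (let T = topology_generated_by
                {{z \<in> U \<times> V. s z \<noteq> 0} | U V s.
                   openin (ztop X) U \<and> openin (ztop Y) V \<and> s \<in> tensor_functions X Y U V} in
      \<lparr>ztop = T,
       regular = (\<lambda>W. {f. \<forall>z\<in>W. \<exists>N U V. openin T N \<and> z \<in> N \<and> N \<subseteq> W \<inter> (U \<times> V) \<and>
                     openin (ztop X) U \<and> openin (ztop Y) V \<and>
                     (\<exists>s\<in>tensor_functions X Y U V. \<exists>t\<in>tensor_functions X Y U V.
                        \<forall>w\<in>N. t w \<noteq> 0 \<and> f w = s w / t w)})\<rparr>)"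

definition variety :: "'a fspace \<Rightarrow> bool" where
  "variety X \<longleftrightarrow>
     function_sheaf X \<and>
     (\<exists>\<U>. finite \<U> \<and> \<Union>\<U> = points X \<and>
        (\<forall>U\<in>\<U>. openin (ztop X) U \<and> affine_variety (open_subspace X U))) \<and>
     closedin (ztop (prod_space X X)) {(x, x) | x. x \<in> points X}"


section \<open>Rational maps\<close>

definition open_dense :: "'a topology \<Rightarrow> 'a set \<Rightarrow> bool" where
  "open_dense T W \<longleftrightarrow> openin T W \<and> T closure_of W = topspace T"

text \<open>A representative of a rational map, as a partial function.\<close>

definition rational_rep :: "'a fspace \<Rightarrow> 'b fspace \<Rightarrow> ('a \<rightharpoonup> 'b) \<Rightarrow> bool" where
  "rational_rep X Y f \<longleftrightarrow>
     open_dense (ztop X) (dom f) \<and> morphism (open_subspace X (dom f)) Y (the \<circ> f)"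

text \<open>Equality as rational maps; it is also used for composites of partial functions.\<close>

definition rat_eq :: "'a fspace \<Rightarrow> ('a \<rightharpoonup> 'b) \<Rightarrow> ('a \<rightharpoonup> 'b) \<Rightarrow> bool" where
  "rat_eq X f g \<longleftrightarrow>
     (\<exists>W. open_dense (ztop X) W \<and> W \<subseteq> dom f \<inter> dom g \<and> (\<forall>x\<in>W. f x = g x))"

text \<open>
  A rational map is identified with its representative of largest domain, so that \<open>dom f\<close> is the
  domain of definition of the rational map \<open>f\<close>.
\<close>

definition rational_map :: "'a fspace \<Rightarrow> 'b fspace \<Rightarrow> ('a \<rightharpoonup> 'b) \<Rightarrow> bool" where
  "rational_map X Y f \<longleftrightarrow>
     rational_rep X Y f \<and> (\<forall>g. rational_rep X Y g \<and> rat_eq X f g \<longrightarrow> dom g \<subseteq> dom f)"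

text \<open>
  A birational map is given by an isomorphism from an open dense subset of \<open>X\<close> onto an open dense
  subset of \<open>Y\<close>, not required to be maximal. Hence \<open>x \<in> dom f\<close> says that \<open>f\<close> is defined at \<open>x\<close>
  as a birational map, i.e. that it is a local isomorphism at \<open>x\<close>. This is more than being defined
  at \<open>x\<close> as a rational map: a blow-down is not defined in this sense on the exceptional curve.
\<close>

definition birational_map :: "'a fspace \<Rightarrow> 'b fspace \<Rightarrow> ('a \<rightharpoonup> 'b) \<Rightarrow> bool" where
  "birational_map X Y f \<longleftrightarrow>
     rational_rep X Y f \<and>
     (\<exists>g. rational_rep Y X g \<and> (\<forall>x y. f x = Some y \<longleftrightarrow> g y = Some x))"


section \<open>Geometric crystals\<close>

text \<open>
  The Kac--Moody algebra enters the theory of geometric crystals only through its Cartan matrix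
  \<open>a\<^sub>i\<^sub>j = \<alpha>\<^sub>j(\<alpha>\<^sub>i\<^sup>\<or>)\<close>, here \<open>A i j\<close>.
\<close>

definition symmetrizable_gcm :: "'i set \<Rightarrow> ('i \<Rightarrow> 'i \<Rightarrow> int) \<Rightarrow> bool" where
  "symmetrizable_gcm I A \<longleftrightarrow>
     finite I \<and>
     (\<forall>i\<in>I. A i i = 2) \<and>
     (\<forall>i\<in>I. \<forall>j\<in>I. i \<noteq> j \<longrightarrow> A i j \<le> 0) \<and>
     (\<forall>i\<in>I. \<forall>j\<in>I. A i j = 0 \<longrightarrow> A j i = 0) \<and>
     (\<exists>d :: 'i \<Rightarrow> complex. (\<forall>i\<in>I. d i \<noteq> 0) \<and>
        (\<forall>i\<in>I. \<forall>j\<in>I. d i * of_int (A i j) = d j * of_int (A j i)))"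

record ('i, 'a) crystal =
  base :: "'a fspace"
  action :: "'i \<Rightarrow> complex \<times> 'a \<rightharpoonup> 'a"
  gam :: "'i \<Rightarrow> 'a \<rightharpoonup> complex"
  eps :: "'i \<Rightarrow> 'a \<rightharpoonup> complex"

abbreviation e_pow :: "('i, 'a) crystal \<Rightarrow> 'i \<Rightarrow> complex \<Rightarrow> 'a \<rightharpoonup> 'a" where
  "e_pow \<X> i c \<equiv> (\<lambda>x. action \<X> i (c, x))"

definition rational_action :: "'a fspace \<Rightarrow> (complex \<times> 'a \<rightharpoonup> 'a) \<Rightarrow> bool" where
  "rational_action X e \<longleftrightarrow>
     rational_map (prod_space mult_group X) X e \<and>
     (\<forall>x y. e (1, x) = Some y \<longrightarrow> y = x) \<and>
     (\<forall>c d. c \<noteq> 0 \<and> d \<noteq> 0 \<longrightarrow>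
        rat_eq X ((\<lambda>x. e (c, x)) \<circ>\<^sub>m (\<lambda>x. e (d, x))) (\<lambda>x. e (c * d, x)))"

definition verma_relations ::
  "'a fspace \<Rightarrow> int \<Rightarrow> int \<Rightarrow> (complex \<Rightarrow> 'a \<rightharpoonup> 'a) \<Rightarrow> (complex \<Rightarrow> 'a \<rightharpoonup> 'a) \<Rightarrow> bool" where
  "verma_relations X aij aji ei ej \<longleftrightarrow>
     (\<forall>c1 c2. c1 \<noteq> 0 \<and> c2 \<noteq> 0 \<longrightarrow>
        (aij = 0 \<and> aji = 0 \<longrightarrow>
           rat_eq X (ei c1 \<circ>\<^sub>m ej c2) (ej c2 \<circ>\<^sub>m ei c1)) \<and>
        (aij = -1 \<and> aji = -1 \<longrightarrow>
           rat_eq X (ei c1 \<circ>\<^sub>m ej (c1 * c2) \<circ>\<^sub>m ei c2)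
                    (ej c2 \<circ>\<^sub>m ei (c1 * c2) \<circ>\<^sub>m ej c1)) \<and>
        (aij = -2 \<and> aji = -1 \<longrightarrow>
           rat_eq X (ei c1 \<circ>\<^sub>m ej (c1 ^ 2 * c2) \<circ>\<^sub>m ei (c1 * c2) \<circ>\<^sub>m ej c2)
                    (ej c2 \<circ>\<^sub>m ei (c1 * c2) \<circ>\<^sub>m ej (c1 ^ 2 * c2) \<circ>\<^sub>m ei c1)) \<and>
        (aij = -3 \<and> aji = -1 \<longrightarrow>
           rat_eq X (ei c1 \<circ>\<^sub>m ej (c1 ^ 3 * c2) \<circ>\<^sub>m ei (c1 ^ 2 * c2) \<circ>\<^sub>m ej (c1 ^ 3 * c2 ^ 2)
                       \<circ>\<^sub>m ei (c1 * c2) \<circ>\<^sub>m ej c2)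
                    (ej c2 \<circ>\<^sub>m ei (c1 * c2) \<circ>\<^sub>m ej (c1 ^ 3 * c2 ^ 2) \<circ>\<^sub>m ei (c1 ^ 2 * c2)
                       \<circ>\<^sub>m ej (c1 ^ 3 * c2) \<circ>\<^sub>m ei c1)))"

definition geometric_crystal ::
  "'i set \<Rightarrow> ('i \<Rightarrow> 'i \<Rightarrow> int) \<Rightarrow> ('i, 'a) crystal \<Rightarrow> bool" where
  "geometric_crystal I A \<X> \<longleftrightarrow>
     variety (base \<X>) \<and>
     (\<forall>i\<in>I. rational_action (base \<X>) (action \<X> i)) \<and>
     (\<forall>i\<in>I. rational_map (base \<X>) affine_line (gam \<X> i)) \<and>
     (\<forall>i\<in>I. rational_map (base \<X>) affine_line (eps \<X> i)) \<and>
     (\<forall>i\<in>I. open_dense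
        (subtopology (ztop (prod_space mult_group (base \<X>))) ({1} \<times> points (base \<X>)))
        (({1} \<times> points (base \<X>)) \<inter> dom (action \<X> i))) \<and>
     (\<forall>i\<in>I. \<forall>j\<in>I. \<forall>c. c \<noteq> 0 \<longrightarrow>
        rat_eq (base \<X>) (gam \<X> j \<circ>\<^sub>m e_pow \<X> i c)
          (\<lambda>x. map_option (\<lambda>v. c powi A i j * v) (gam \<X> j x))) \<and>
     (\<forall>i\<in>I. \<forall>j\<in>I. verma_relations (base \<X>) (A i j) (A j i) (e_pow \<X> i) (e_pow \<X> j)) \<and>
     (\<forall>i\<in>I. \<forall>c. c \<noteq> 0 \<longrightarrow>
        rat_eq (base \<X>) (eps \<X> i \<circ>\<^sub>m e_pow \<X> i c)
          (\<lambda>x. map_option (\<lambda>v. inverse c * v) (eps \<X> i x)))"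

definition crystal_isomorphism ::
  "'i set \<Rightarrow> ('i, 'a) crystal \<Rightarrow> ('i, 'b) crystal \<Rightarrow> ('a \<rightharpoonup> 'b) \<Rightarrow> bool" where
  "crystal_isomorphism I \<X> \<Y> \<phi> \<longleftrightarrow>
     birational_map (base \<X>) (base \<Y>) \<phi> \<and>
     (\<forall>i\<in>I. \<forall>c. c \<noteq> 0 \<longrightarrow>
        rat_eq (base \<X>) (\<phi> \<circ>\<^sub>m e_pow \<X> i c) (e_pow \<Y> i c \<circ>\<^sub>m \<phi>)) \<and>
     (\<forall>i\<in>I. rat_eq (base \<X>) (gam \<Y> i \<circ>\<^sub>m \<phi>) (gam \<X> i)) \<and>
     (\<forall>i\<in>I. rat_eq (base \<X>) (eps \<Y> i \<circ>\<^sub>m \<phi>) (eps \<X> i))"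

text \<open>
  The points obtained from \<open>x\<close> by successively applying maps \<open>e\<^sub>i\<^sup>c\<close>, each defined at the point to
  which it is applied. As the actions are only partially defined, this relation need not be
  symmetric, so an orbit is required to be the orbit of each of its points.
\<close>

inductive_set orbit_of :: "'i set \<Rightarrow> ('i, 'a) crystal \<Rightarrow> 'a \<Rightarrow> 'a set"
  for I :: "'i set" and \<X> :: "('i, 'a) crystal" and x :: 'a where
  start: "x \<in> orbit_of I \<X> x"
| step: "y \<in> orbit_of I \<X> x \<Longrightarrow> i \<in> I \<Longrightarrow> c \<noteq> 0 \<Longrightarrow> e_pow \<X> i c y = Some z \<Longrightarrow> z \<in> orbit_of I \<X> x"

definition is_orbit :: "'i set \<Rightarrow> ('i, 'a) crystal \<Rightarrow> 'a set \<Rightarrow> bool" where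
  "is_orbit I \<X> \<Omega> \<longleftrightarrow> \<Omega> \<noteq> {} \<and> (\<forall>x\<in>\<Omega>. orbit_of I \<X> x = \<Omega>)"

definition prehomogeneous :: "'i set \<Rightarrow> ('i, 'a) crystal \<Rightarrow> bool" where
  "prehomogeneous I \<X> \<longleftrightarrow> (\<exists>\<Omega>. open_dense (ztop (base \<X>)) \<Omega> \<and> is_orbit I \<X> \<Omega>)"

end

theory Submission
  imports Defs
begin

text \<open>
  Let \<open>\<psi>\<close> be the inverse of \<open>\<phi>'\<close> and put \<open>g = \<psi> \<circ>\<^sub>m \<phi>\<close>. This is a birational map from the first
  crystal to itself which commutes, as a rational map, with every \<open>e\<^sub>i\<^sup>c\<close>. It is defined at \<open>p1\<close> and
  fixes it, and \<open>g x = Some x\<close> says precisely that \<open>\<phi>\<close> and \<open>\<phi>'\<close> are defined and agree at \<open>x\<close>. So it is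
  enough to show that \<open>g\<close> fixes every point \<open>q\<close> of the open dense set \<open>\<Omega>1 \<inter> dom g\<close>.

  Write \<open>q = E(p1)\<close> for a composite \<open>E\<close> of maps \<open>e\<^sub>i\<^sup>c\<close>. One cannot push the equation \<open>g(p1) = p1\<close>
  through the factors of \<open>E\<close> one at a time, as the intermediate points may lie outside the domain of
  \<open>g\<close>. But \<open>g \<circ>\<^sub>m E\<close> and \<open>E \<circ>\<^sub>m g\<close> are
  equal as rational maps, and both are defined at \<open>p1\<close>, the first because \<open>q\<close> lies in \<open>dom g\<close> and
  the second because \<open>g\<close> fixes \<open>p1\<close>. As a variety is separated, their values \<open>g(q)\<close> and \<open>q\<close> at \<open>p1\<close>
  coincide (\<open>rat_eq_at_common_point\<close>).

  Composing rational maps is legitimate only if preimages of open dense sets are dense. The maps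
  with this property, here called dominant, are closed under composition, and equality of rational
  maps is a congruence for it. A rational map with a rational inverse is dominant
  (\<open>dominant_if_rational_inverse\<close>); for \<open>e\<^sub>i\<^sup>c\<close> the inverse is \<open>e\<^sub>i\<^sup>1\<^sup>/\<^sup>c\<close>. The remaining work is to see that
  fixing \<open>c\<close> in the action turns it into a morphism on an open subset (\<open>partial_morphism_slice\<close>);
  this, like separatedness, refers to the topology on a product, and therefore rests on the fact
  that regular functions on a variety have open non-vanishing loci and are invertible there
  (\<open>variety_inverse_local\<close>).
\<close>

section \<open>Open dense sets\<close>

lemma open_dense_iff:
  "open_dense T W \<longleftrightarrow> openin T W \<and> (\<forall>V. openin T V \<and> V \<noteq> {} \<longrightarrow> (\<exists>x\<in>V. x \<in> W))"
  unfolding open_dense_def dense_intersects_open by blast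

lemma open_dense_Int:
  assumes "open_dense T V" "open_dense T W"
  shows "open_dense T (V \<inter> W)"
  unfolding open_dense_iff
proof (intro conjI allI impI)
  show "openin T (V \<inter> W)"
    using assms by (simp add: open_dense_iff openin_Int)
next
  fix N assume N: "openin T N \<and> N \<noteq> {}"
  then have "openin T (N \<inter> V)" "N \<inter> V \<noteq> {}"
    using assms(1) by (auto simp: open_dense_iff openin_Int)
  then show "\<exists>x\<in>N. x \<in> V \<inter> W"
    using assms(2) unfolding open_dense_iff by blast
qed


section \<open>Regular functions on a variety\<close>

lemma sheaf_const:
  "function_sheaf X \<Longrightarrow> openin (ztop X) U \<Longrightarrow> (\<lambda>_. a) \<in> regular X U"
  by (simp add: function_sheaf_def)

lemma sheaf_add:
  "function_sheaf X \<Longrightarrow> openin (ztop X) U \<Longrightarrow> f \<in> regular X U \<Longrightarrow> g \<in> regular X U \<Longrightarrow>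
   (\<lambda>x. f x + g x) \<in> regular X U"
  unfolding function_sheaf_def by blast

lemma sheaf_mult:
  "function_sheaf X \<Longrightarrow> openin (ztop X) U \<Longrightarrow> f \<in> regular X U \<Longrightarrow> g \<in> regular X U \<Longrightarrow>
   (\<lambda>x. f x * g x) \<in> regular X U"
  unfolding function_sheaf_def by blast

lemma sheaf_cong:
  assumes "function_sheaf X" "openin (ztop X) U" "f \<in> regular X U" "\<And>x. x \<in> U \<Longrightarrow> g x = f x"
  shows "g \<in> regular X U"
proof -
  have "\<forall>f\<in>regular X U. \<forall>g. (\<forall>x\<in>U. g x = f x) \<longrightarrow> g \<in> regular X U"
    using assms(1,2) unfolding function_sheaf_def by blast
  from bspec[OF this assms(3)] show ?thesis using assms(4) by simp
qed

lemma sheaf_restrict: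
  "function_sheaf X \<Longrightarrow> openin (ztop X) U \<Longrightarrow> f \<in> regular X U \<Longrightarrow> openin (ztop X) V \<Longrightarrow> V \<subseteq> U \<Longrightarrow>
   f \<in> regular X V"
  unfolding function_sheaf_def by blast

lemma sheaf_glue:
  assumes "function_sheaf X" "openin (ztop X) U"
    and "\<And>x. x \<in> U \<Longrightarrow> \<exists>V. openin (ztop X) V \<and> x \<in> V \<and> V \<subseteq> U \<and> f \<in> regular X V"
  shows "f \<in> regular X U"
proof -
  have "\<forall>f. (\<forall>x\<in>U. \<exists>V. openin (ztop X) V \<and> x \<in> V \<and> V \<subseteq> U \<and> f \<in> regular X V) \<longrightarrow> f \<in> regular X U"
    using assms(1,2) unfolding function_sheaf_def by blast
  from spec[OF this, of f] show ?thesis using assms(3) by simp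
qed

lemma sheaf_sum:
  fixes n :: nat
  assumes "function_sheaf X" "openin (ztop X) U" "\<And>k. k < n \<Longrightarrow> f k \<in> regular X U"
  shows "(\<lambda>x. \<Sum>k<n. f k x) \<in> regular X U"
  using assms(3)
proof (induction n)
  case 0
  then show ?case using sheaf_const[OF assms(1,2)] by simp
next
  case (Suc n)
  then show ?case using sheaf_add[OF assms(1,2), of "\<lambda>x. \<Sum>k<n. f k x" "f n"] by simp
qed

lemma quotient_space_points: "points (quotient_space Z P) \<subseteq> Z"
  by (auto simp: quotient_space_def Let_def topology_generated_by_topspace)

lemma quotient_space_regular_iff:
  "f \<in> regular (quotient_space Z P) U \<longleftrightarrow>
     (\<forall>x\<in>U. \<exists>N. openin (ztop (quotient_space Z P)) N \<and> x \<in> N \<and> N \<subseteq> U \<and>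
        (\<exists>p\<in>P. \<exists>q\<in>P. \<forall>y\<in>N. q y \<noteq> 0 \<and> f y = p y / q y))"
  by (simp add: quotient_space_def Let_def)

lemma quotient_space_nonvanishing_open:
  assumes "openin (ztop (quotient_space Z P)) N" "p \<in> P"
  shows "openin (ztop (quotient_space Z P)) {x \<in> N. p x \<noteq> 0}"
proof -
  have "openin (ztop (quotient_space Z P)) {x \<in> Z. p x \<noteq> 0}"
    unfolding quotient_space_def Let_def using assms(2)
    by (auto intro!: topology_generated_by_Basis)
  moreover have "{x \<in> N. p x \<noteq> 0} = N \<inter> {x \<in> Z. p x \<noteq> 0}"
    using openin_subset[OF assms(1)] quotient_space_points[of Z P] by blast
  ultimately show ?thesis using assms(1) by (simp add: openin_Int)
qed

text \<open>
  In an affine chart \<open>f\<close> is near \<open>x\<close> a quotient \<open>p / q\<close> of polynomial functions, and \<open>q / p\<close> is its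
  inverse where \<open>p\<close> does not vanish. The sheaf axioms alone do not give this.
\<close>

lemma variety_inverse_local:
  assumes X: "variety X" and U: "openin (ztop X) U" and f: "f \<in> regular X U"
    and x: "x \<in> U" "f x \<noteq> 0"
  shows "\<exists>M. openin (ztop X) M \<and> x \<in> M \<and> M \<subseteq> {x \<in> U. f x \<noteq> 0} \<and>
             (\<lambda>x. inverse (f x)) \<in> regular X M"
proof -
  have sh: "function_sheaf X" using X by (simp add: variety_def)
  have "x \<in> points X" using openin_subset[OF U] x by blast
  then obtain A where A: "openin (ztop X) A" "x \<in> A" "affine_variety (open_subspace X A)"
    using X unfolding variety_def by blast
  then obtain n S where "isomorphic_spaces (open_subspace X A)
        (quotient_space (zero_locus n S) (poly_functions n))"
    unfolding affine_variety_def by blast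
  moreover define Z where "Z = zero_locus n S"
  moreover define P where "P = poly_functions n"
  moreover define Q where "Q = quotient_space Z P"
  moreover define XA where "XA = open_subspace X A"
  ultimately obtain a b where a: "morphism XA Q a" and b: "morphism Q XA b"
    and ba: "\<forall>x\<in>points XA. b (a x) = x"
    unfolding isomorphic_spaces_def by auto
  have pXA: "points XA = A" "ztop XA = subtopology (ztop X) A" "regular XA = regular X"
    using openin_subset[OF A(1)] by (auto simp: XA_def open_subspace_def)
  have UA: "openin (ztop X) (U \<inter> A)" "openin (ztop XA) (U \<inter> A)"
    using U A(1) by (auto simp: pXA openin_Int openin_subtopology)
  have "f \<in> regular XA (U \<inter> A)"
    using sheaf_restrict[OF sh U f UA(1)] by (simp add: pXA)
  then have "f \<circ> b \<in> regular Q (points Q \<inter> b -` (U \<inter> A))"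
    using b UA(2) unfolding morphism_def by blast
  moreover have "a x \<in> points Q \<inter> b -` (U \<inter> A)"
  proof -
    have "a \<in> points XA \<rightarrow> points Q" using a by (simp add: morphism_def continuous_map_def)
    moreover have "x \<in> points XA" "b (a x) = x" using A(2) ba by (simp_all add: pXA(1))
    ultimately show ?thesis using A(2) x(1) by auto
  qed
  ultimately have "\<exists>N. openin (ztop Q) N \<and> a x \<in> N \<and> N \<subseteq> points Q \<inter> b -` (U \<inter> A) \<and>
      (\<exists>p\<in>P. \<exists>q\<in>P. \<forall>y\<in>N. q y \<noteq> 0 \<and> (f \<circ> b) y = p y / q y)"
    unfolding Q_def quotient_space_regular_iff by (rule bspec)
  then obtain N p q where N: "openin (ztop Q) N" "a x \<in> N"
      "N \<subseteq> points Q \<inter> b -` (U \<inter> A)" and p: "p \<in> P" and q: "q \<in> P"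
    and fb: "\<forall>y\<in>N. q y \<noteq> 0 \<and> f (b y) = p y / q y"
    unfolding comp_def by metis
  define N' where "N' = {y \<in> N. p y \<noteq> 0}"
  have N': "openin (ztop Q) N'"
    using quotient_space_nonvanishing_open[of Z P N p] N(1) p by (simp add: Q_def N'_def)
  have "(\<lambda>y. q y / p y) \<in> regular Q N'"
    using N' p q unfolding Q_def quotient_space_regular_iff
    by (intro ballI exI[of _ N'] conjI bexI[of _ q] bexI[of _ p]) (auto simp: N'_def)
  define M where "M = points XA \<inter> a -` N'"
  have "openin (ztop XA) M"
    using a N' unfolding morphism_def M_def by (auto simp: continuous_map vimage_def Int_def)
  then have M: "openin (ztop X) M"
    using A(1) by (metis pXA(2) openin_trans_full)
  have qpa: "(\<lambda>y. q y / p y) \<circ> a \<in> regular X M"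
    using a N' \<open>(\<lambda>y. q y / p y) \<in> regular Q N'\<close> unfolding morphism_def M_def pXA(3)[symmetric]
    by blast
  have fM: "y \<in> U" "f y = p (a y) / q (a y)" "p (a y) \<noteq> 0" "q (a y) \<noteq> 0" if "y \<in> M" for y
  proof -
    have y: "b (a y) = y" "a y \<in> N" and py: "p (a y) \<noteq> 0"
      using that ba by (auto simp: M_def N'_def)
    then show "y \<in> U" using N(3) by force
    show "f y = p (a y) / q (a y)" "q (a y) \<noteq> 0" using y fb by auto
    show "p (a y) \<noteq> 0" by (fact py)
  qed
  have "b (a x) = x" using ba A(2) by (simp add: pXA(1))
  then have "p (a x) \<noteq> 0" using N(2) fb x(2) by auto
  then have "x \<in> M"
    using N(2) A(2) by (auto simp: M_def N'_def pXA(1))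
  moreover have "M \<subseteq> {x \<in> U. f x \<noteq> 0}" using fM by auto
  moreover have "(\<lambda>x. inverse (f x)) \<in> regular X M"
    by (rule sheaf_cong[OF sh M qpa]) (simp add: fM)
  ultimately show ?thesis using M by blast
qed

lemma variety_nonvanishing_open:
  assumes "variety X" "openin (ztop X) U" "f \<in> regular X U"
  shows "openin (ztop X) {x \<in> U. f x \<noteq> 0}"
  by (subst openin_subopen) (use variety_inverse_local[OF assms] in blast)

lemma variety_inverse_regular:
  assumes "variety X" "openin (ztop X) U" "f \<in> regular X U" "\<And>x. x \<in> U \<Longrightarrow> f x \<noteq> 0"
  shows "(\<lambda>x. inverse (f x)) \<in> regular X U"
proof (rule sheaf_glue)
  show "function_sheaf X" using assms(1) by (simp add: variety_def)
  show "\<exists>V. openin (ztop X) V \<and> x \<in> V \<and> V \<subseteq> U \<and> (\<lambda>x. inverse (f x)) \<in> regular X V"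
    if "x \<in> U" for x
    using variety_inverse_local[OF assms(1-3) that] assms(4)[OF that] by blast
qed (fact assms(2))


section \<open>Partial morphisms\<close>

definition preimage :: "('a \<rightharpoonup> 'b) \<Rightarrow> 'b set \<Rightarrow> 'a set" where
  "preimage f V = {x. \<exists>y\<in>V. f x = Some y}"

text \<open>
  The morphisms from some open subset of \<open>X\<close> to \<open>Y\<close>, phrased with preimages under the partial
  function itself, so that composition needs no bookkeeping of domains.
\<close>

definition partial_morphism :: "'a fspace \<Rightarrow> 'b fspace \<Rightarrow> ('a \<rightharpoonup> 'b) \<Rightarrow> bool" where
  "partial_morphism X Y f \<longleftrightarrow>
     ran f \<subseteq> points Y \<and>
     (\<forall>V. openin (ztop Y) V \<longrightarrow>
        openin (ztop X) (preimage f V) \<and>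
        (\<forall>h\<in>regular Y V. (\<lambda>x. h (the (f x))) \<in> regular X (preimage f V)))"

lemma preimage_points:
  "partial_morphism X Y f \<Longrightarrow> preimage f (points Y) = dom f"
  by (auto simp: partial_morphism_def preimage_def dom_def ran_def)

lemma partial_morphism_regular:
  "partial_morphism X Y f \<Longrightarrow> openin (ztop Y) V \<Longrightarrow> h \<in> regular Y V \<Longrightarrow>
   (\<lambda>x. h (the (f x))) \<in> regular X (preimage f V)"
  by (simp add: partial_morphism_def)

lemma preimage_comp: "preimage (f \<circ>\<^sub>m g) V = preimage g (preimage f V)"
  by (auto simp: preimage_def map_comp_def split: option.splits)

lemma partial_morphism_comp:
  assumes X: "function_sheaf X" and f: "partial_morphism Y Z f" and g: "partial_morphism X Y g"
  shows "partial_morphism X Z (f \<circ>\<^sub>m g)"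
  unfolding partial_morphism_def
proof (intro conjI allI impI ballI)
  show "ran (f \<circ>\<^sub>m g) \<subseteq> points Z"
    using f by (fastforce simp: partial_morphism_def ran_def map_comp_def split: option.splits)
next
  fix V assume V: "openin (ztop Z) V"
  show o: "openin (ztop X) (preimage (f \<circ>\<^sub>m g) V)"
    using f g V by (simp add: partial_morphism_def preimage_comp)
  fix h assume "h \<in> regular Z V"
  then have "(\<lambda>y. h (the (f y))) \<in> regular Y (preimage f V)" "openin (ztop Y) (preimage f V)"
    using f V by (simp_all add: partial_morphism_def)
  from partial_morphism_regular[OF g this(2,1)]
  have "(\<lambda>x. h (the (f (the (g x))))) \<in> regular X (preimage (f \<circ>\<^sub>m g) V)"
    by (simp add: preimage_comp)
  then show "(\<lambda>x. h (the ((f \<circ>\<^sub>m g) x))) \<in> regular X (preimage (f \<circ>\<^sub>m g) V)"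
    by (rule sheaf_cong[OF X o]) (auto simp: preimage_def map_comp_def split: option.splits)
qed

lemma rational_rep_iff:
  "rational_rep X Y f \<longleftrightarrow> open_dense (ztop X) (dom f) \<and> partial_morphism X Y f"
proof (cases "openin (ztop X) (dom f)")
  case True
  define D where "D = open_subspace X (dom f)"
  have D: "points D = dom f" "regular D = regular X"
    using openin_subset[OF True] by (auto simp: D_def open_subspace_def)
  have "openin (ztop D) W \<longleftrightarrow> openin (ztop X) W" if "W \<subseteq> dom f" for W
    using openin_subtopology_alt that True openin_open_subtopology[OF True, of W]
    by (simp add: D_def open_subspace_def)
  moreover have pre: "dom f \<inter> (the \<circ> f) -` V = preimage f V" for V
    by (auto simp: preimage_def)
  moreover have "preimage f V \<subseteq> dom f" for V by (auto simp: preimage_def)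
  moreover have "{x \<in> dom f. (the \<circ> f) x \<in> V} = preimage f V" for V
    by (auto simp: preimage_def)
  moreover have "(the \<circ> f) \<in> dom f \<rightarrow> points Y \<longleftrightarrow> ran f \<subseteq> points Y"
    by (force simp: ran_def Pi_def dom_def)
  ultimately have "morphism D Y (the \<circ> f) \<longleftrightarrow> partial_morphism X Y f"
    unfolding morphism_def partial_morphism_def continuous_map_def D pre
    by (auto simp: comp_def)
  then show ?thesis by (simp add: rational_rep_def D_def)
next
  case False
  then show ?thesis by (simp add: rational_rep_def open_dense_def)
qed

text \<open>
  The locus is the preimage of the complement of the diagonal of \<open>Y\<close>. The topology on \<open>Y \<times> Y\<close> is
  finer than the product topology, so continuity of \<open>f\<close> and \<open>g\<close> does not suffice: a basic open set
  is the non-vanishing locus of a sum of products \<open>a\<^sub>k(y) b\<^sub>k(z)\<close>, and its preimage is the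
  non-vanishing locus of the regular function with summands \<open>a\<^sub>k(f x) b\<^sub>k(g x)\<close>.
\<close>

lemma disagreement_locus_open:
  assumes X: "variety X" and Y: "variety Y"
    and f: "partial_morphism X Y f" and g: "partial_morphism X Y g"
  shows "openin (ztop X) {x \<in> dom f \<inter> dom g. f x \<noteq> g x}"
proof -
  have sh: "function_sheaf X" using X by (simp add: variety_def)
  define pull where "pull W = {x \<in> dom f \<inter> dom g. (the (f x), the (g x)) \<in> W}" for W
  define B where "B = {{z \<in> U \<times> V. s z \<noteq> 0} | U V s.
      openin (ztop Y) U \<and> openin (ztop Y) V \<and> s \<in> tensor_functions Y Y U V}"
  have zt: "ztop (prod_space Y Y) = topology_generated_by B"
    by (simp add: prod_space_def Let_def B_def)
  have basic: "openin (ztop X) (pull W)" if WB: "W \<in> B" for W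
  proof -
    obtain U V s where W: "W = {z \<in> U \<times> V. s z \<noteq> 0}" and UV: "openin (ztop Y) U" "openin (ztop Y) V"
      and "s \<in> tensor_functions Y Y U V"
      using WB unfolding B_def by blast
    then obtain n :: nat and a b where s: "s = (\<lambda>(x, y). \<Sum>k<n. a k x * b k y)"
      and ab: "\<And>k. k < n \<Longrightarrow> a k \<in> regular Y U" "\<And>k. k < n \<Longrightarrow> b k \<in> regular Y V"
      unfolding tensor_functions_def by blast
    define N where "N = preimage f U \<inter> preimage g V"
    have o: "openin (ztop X) (preimage f U)" "openin (ztop X) (preimage g V)"
      using f g UV by (auto simp: partial_morphism_def)
    then have N: "openin (ztop X) N" by (simp add: N_def openin_Int)
    have "(\<lambda>x. \<Sum>k<n. a k (the (f x)) * b k (the (g x))) \<in> regular X N"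
    proof (intro sheaf_sum[OF sh N] sheaf_mult[OF sh N])
      fix k assume k: "k < n"
      from partial_morphism_regular[OF f UV(1) ab(1)[OF k]]
      show "(\<lambda>x. a k (the (f x))) \<in> regular X N"
        by (rule sheaf_restrict[OF sh o(1) _ N]) (simp add: N_def)
      from partial_morphism_regular[OF g UV(2) ab(2)[OF k]]
      show "(\<lambda>x. b k (the (g x))) \<in> regular X N"
        by (rule sheaf_restrict[OF sh o(2) _ N]) (simp add: N_def)
    qed
    from variety_nonvanishing_open[OF X N this] show ?thesis
      by (rule back_subst[of "openin (ztop X)"])
         (auto simp: pull_def W s N_def preimage_def)
  qed
  have "openin (ztop X) (pull W)" if "openin (ztop (prod_space Y Y)) W" for W
  proof -
    have "generate_topology_on B W"
      using that by (simp add: zt openin_topology_generated_by_iff)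
    then show ?thesis
    proof induction
      case Empty
      then show ?case by (simp add: pull_def)
    next
      case (Int V W)
      moreover have "pull (V \<inter> W) = pull V \<inter> pull W" by (auto simp: pull_def)
      ultimately show ?case by (simp add: openin_Int)
    next
      case (UN K)
      moreover have "pull (\<Union>K) = \<Union>(pull ` K)" by (auto simp: pull_def)
      ultimately show ?case by (metis (no_types, lifting) imageE openin_Union)
    next
      case (Basis W)
      then show ?case by (rule basic)
    qed
  qed
  moreover have "closedin (ztop (prod_space Y Y)) {(y, y) | y. y \<in> points Y}"
    using Y by (simp add: variety_def)
  moreover have "(y, z) \<in> points (prod_space Y Y)" if yz: "y \<in> points Y" "z \<in> points Y" for y z
  proof -
    have "(\<lambda>_. 1) \<in> regular Y (points Y)"
      using Y by (auto simp: variety_def intro: sheaf_const)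
    moreover define s :: "'b \<times> 'b \<Rightarrow> complex" where "s = (\<lambda>(x, y). \<Sum>k<(1::nat). 1 * 1)"
    ultimately have "s \<in> tensor_functions Y Y (points Y) (points Y)"
      unfolding tensor_functions_def
      by (intro CollectI exI[of _ 1] exI[of _ "\<lambda>_ _. 1"]) simp
    then have "{z \<in> points Y \<times> points Y. s z \<noteq> 0} \<in> B"
      unfolding B_def by blast
    moreover have "(y, z) \<in> {z \<in> points Y \<times> points Y. s z \<noteq> 0}"
      using yz by (simp add: s_def)
    ultimately show ?thesis
      unfolding zt topology_generated_by_topspace by blast
  qed
  ultimately have "openin (ztop X)
      (pull (points (prod_space Y Y) - {(y, y) | y. y \<in> points Y}))" (is "openin _ (pull ?W)")
    by blast
  moreover have "pull ?W = {x \<in> dom f \<inter> dom g. f x \<noteq> g x}"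
  proof -
    have r: "the (f x) \<in> points Y" if "x \<in> dom f" for x
      using f that by (auto simp: partial_morphism_def ran_def)
    have r': "the (g x) \<in> points Y" if "x \<in> dom g" for x
      using g that by (auto simp: partial_morphism_def ran_def)
    show ?thesis
      using r r' \<open>\<And>z y. y \<in> points Y \<Longrightarrow> z \<in> points Y \<Longrightarrow> (y, z) \<in> points (prod_space Y Y)\<close>
      by (fastforce simp: pull_def)
  qed
  ultimately show ?thesis by simp
qed

text \<open>
  Two maps that are equal as rational maps agree on a dense set, which the open set where they
  disagree has to miss; so they agree wherever both of them are defined.
\<close>

lemma rat_eq_at_common_point:
  assumes "variety X" "variety Y" "partial_morphism X Y f" "partial_morphism X Y g"
    and fg: "rat_eq X f g" and x: "x \<in> dom f" "x \<in> dom g"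
  shows "f x = g x"
proof (rule ccontr)
  assume "f x \<noteq> g x"
  then have "{x \<in> dom f \<inter> dom g. f x \<noteq> g x} \<noteq> {}" using x by blast
  moreover obtain W where "open_dense (ztop X) W" "\<forall>x\<in>W. f x = g x"
    using fg unfolding rat_eq_def by blast
  ultimately show False
    using disagreement_locus_open[OF assms(1-4)] unfolding open_dense_iff by blast
qed


section \<open>Dominant rational maps\<close>

text \<open>
  Density of the preimages of all open dense sets is what makes composites of rational maps
  rational; taking \<open>W = points Y\<close> shows that the domain itself is dense. For irreducible varieties
  this is the usual condition of dense image, but it makes sense without irreducibility.
\<close>

definition dominant :: "'a fspace \<Rightarrow> 'b fspace \<Rightarrow> ('a \<rightharpoonup> 'b) \<Rightarrow> bool" where
  "dominant X Y f \<longleftrightarrow>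
     partial_morphism X Y f \<and>
     (\<forall>W. open_dense (ztop Y) W \<longrightarrow> open_dense (ztop X) (preimage f W))"

lemma dominant_dom: "dominant X Y f \<Longrightarrow> open_dense (ztop X) (dom f)"
  using preimage_points[of X Y f] unfolding dominant_def
  by (metis closure_of_topspace open_dense_def openin_topspace)

lemma dominant_comp:
  assumes "function_sheaf X" "dominant Y Z f" "dominant X Y g"
  shows "dominant X Z (f \<circ>\<^sub>m g)"
  using assms partial_morphism_comp[of X Y Z f g] by (simp add: dominant_def preimage_comp)

text \<open>
  The total function \<open>Some\<close> is not a partial morphism in general, because its values include the
  elements of the type that are not points of \<open>X\<close>; hence the restriction.
\<close>

lemma dominant_identity:
  assumes "function_sheaf X"
  shows "dominant X X (Some |` points X)"
proof -
  have pre: "preimage (Some |` points X) V = V" if "openin (ztop X) V" for V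
    using openin_subset[OF that] by (auto simp: preimage_def restrict_map_def)
  have "(\<lambda>x. h (the ((Some |` points X) x))) \<in> regular X V"
    if "openin (ztop X) V" "h \<in> regular X V" for V h
    by (rule sheaf_cong[OF assms that]) (use openin_subset[OF that(1)] in auto)
  moreover have "ran (Some |` points X) \<subseteq> points X"
    by (auto simp: ran_def restrict_map_def split: if_splits)
  ultimately have "partial_morphism X X (Some |` points X)"
    by (simp add: partial_morphism_def pre)
  then show ?thesis
    by (simp add: dominant_def pre open_dense_def)
qed

lemma rat_eq_reflexive: "open_dense (ztop X) (dom f) \<Longrightarrow> rat_eq X f f"
  unfolding rat_eq_def by blast

lemma rat_eq_sym: "rat_eq X f g \<Longrightarrow> rat_eq X g f"
  unfolding rat_eq_def by (metis Int_commute)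

lemma rat_eq_trans:
  assumes "rat_eq X f g" "rat_eq X g h"
  shows "rat_eq X f h"
proof -
  obtain V W where "open_dense (ztop X) V" "V \<subseteq> dom f \<inter> dom g" "\<forall>x\<in>V. f x = g x"
    "open_dense (ztop X) W" "W \<subseteq> dom g \<inter> dom h" "\<forall>x\<in>W. g x = h x"
    using assms unfolding rat_eq_def by metis
  then show ?thesis
    unfolding rat_eq_def using open_dense_Int[of "ztop X" V W] by (intro exI[of _ "V \<inter> W"]) auto
qed

lemma rat_eq_comp_right:
  assumes "rat_eq Y f g" "dominant X Y h"
  shows "rat_eq X (f \<circ>\<^sub>m h) (g \<circ>\<^sub>m h)"
proof -
  obtain W where W: "open_dense (ztop Y) W" "W \<subseteq> dom f \<inter> dom g" "\<forall>x\<in>W. f x = g x"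
    using assms(1) unfolding rat_eq_def by blast
  have "open_dense (ztop X) (preimage h W)"
    using assms(2) W(1) by (simp add: dominant_def)
  moreover have "x \<in> dom (f \<circ>\<^sub>m h) \<inter> dom (g \<circ>\<^sub>m h) \<and> (f \<circ>\<^sub>m h) x = (g \<circ>\<^sub>m h) x"
    if x: "x \<in> preimage h W" for x
  proof -
    obtain y where "h x = Some y" "y \<in> W" using x by (auto simp: preimage_def)
    then show ?thesis using W(2,3) by auto
  qed
  ultimately show ?thesis
    unfolding rat_eq_def by blast
qed

lemma rat_eq_comp_left:
  assumes "rat_eq X f g" "dominant X Y f" "dominant Y Z h"
  shows "rat_eq X (h \<circ>\<^sub>m f) (h \<circ>\<^sub>m g)"
proof -
  obtain W where W: "open_dense (ztop X) W" "W \<subseteq> dom f \<inter> dom g" "\<forall>x\<in>W. f x = g x"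
    using assms(1) unfolding rat_eq_def by blast
  have "open_dense (ztop X) (preimage f (dom h))"
    using assms(2) dominant_dom[OF assms(3)] by (simp add: dominant_def)
  then have "open_dense (ztop X) (W \<inter> preimage f (dom h))"
    using W(1) by (rule open_dense_Int[rotated])
  moreover have "x \<in> dom (h \<circ>\<^sub>m f) \<inter> dom (h \<circ>\<^sub>m g) \<and> (h \<circ>\<^sub>m f) x = (h \<circ>\<^sub>m g) x"
    if x: "x \<in> W \<inter> preimage f (dom h)" for x
  proof -
    obtain y z where "f x = Some y" "h y = Some z" using x by (auto simp: preimage_def)
    moreover from this have "g x = Some y" using W(3) x by auto
    ultimately show ?thesis by auto
  qed
  ultimately show ?thesis
    unfolding rat_eq_def by blast
qed

text \<open>
  Given an open dense \<open>W\<close> and a non-empty open \<open>V\<close>, the set of all \<open>y\<close> with \<open>g(y) \<in> V\<close> is open, and it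
  is non-empty since it contains \<open>f(x)\<close> for a generic \<open>x \<in> V\<close>. It therefore contains a point \<open>y \<in> W\<close> with
  \<open>f(g(y)) = y\<close>, and \<open>g(y)\<close> is a point of \<open>V\<close> that \<open>f\<close> maps into \<open>W\<close>.
\<close>

lemma dominant_if_rational_inverse:
  assumes f: "partial_morphism X Y f" and g: "partial_morphism Y X g"
    and gf: "rat_eq X (g \<circ>\<^sub>m f) Some" and fg: "rat_eq Y (f \<circ>\<^sub>m g) Some"
  shows "dominant X Y f"
  unfolding dominant_def open_dense_iff[of "ztop X"]
proof (intro conjI allI impI)
  show "partial_morphism X Y f" by (fact f)
next
  fix W assume W: "open_dense (ztop Y) W"
  show "openin (ztop X) (preimage f W)"
    using f W by (simp add: partial_morphism_def open_dense_def)
  fix V assume V: "openin (ztop X) V \<and> V \<noteq> {}"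
  obtain A where A: "open_dense (ztop X) A" "\<forall>x\<in>A. (g \<circ>\<^sub>m f) x = Some x"
    using gf unfolding rat_eq_def by blast
  obtain B where B: "open_dense (ztop Y) B" "\<forall>y\<in>B. (f \<circ>\<^sub>m g) y = Some y"
    using fg unfolding rat_eq_def by blast
  obtain x where "x \<in> V" "x \<in> A" using V A(1) unfolding open_dense_iff by blast
  then have "preimage g V \<noteq> {}"
    using A(2) by (fastforce simp: preimage_def map_comp_def split: option.splits)
  moreover have "openin (ztop Y) (preimage g V)"
    using g V by (simp add: partial_morphism_def)
  ultimately obtain y where y: "y \<in> preimage g V" "y \<in> W \<inter> B"
    using open_dense_Int[OF W B(1)] unfolding open_dense_iff by blast
  then obtain x' where "g y = Some x'" "x' \<in> V" by (auto simp: preimage_def)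
  moreover from this have "f x' = Some y" using B(2) y(2) by (auto simp: map_comp_def)
  ultimately show "\<exists>x\<in>V. x \<in> preimage f W" using y(2) by (auto simp: preimage_def)
qed

lemma birational_map_dominant_inverse:
  assumes "birational_map X Y f"
  obtains g where "dominant X Y f" "dominant Y X g" "\<And>x y. f x = Some y \<longleftrightarrow> g y = Some x"
    "rat_eq X (g \<circ>\<^sub>m f) Some" "rat_eq Y (f \<circ>\<^sub>m g) Some"
proof -
  obtain g where f: "rational_rep X Y f" and g: "rational_rep Y X g"
    and fg: "\<And>x y. f x = Some y \<longleftrightarrow> g y = Some x"
    using assms unfolding birational_map_def by blast
  have gf: "(g \<circ>\<^sub>m f) x = Some x" if "x \<in> dom f" for x using fg that by auto
  have "rat_eq X (g \<circ>\<^sub>m f) Some"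
    unfolding rat_eq_def using f gf by (intro exI[of _ "dom f"]) (auto simp: rational_rep_iff)
  moreover have fg': "(f \<circ>\<^sub>m g) y = Some y" if "y \<in> dom g" for y using fg that by auto
  have "rat_eq Y (f \<circ>\<^sub>m g) Some"
    unfolding rat_eq_def using g fg' by (intro exI[of _ "dom g"]) (auto simp: rational_rep_iff)
  moreover have "partial_morphism X Y f" "partial_morphism Y X g"
    using f g by (simp_all add: rational_rep_iff)
  ultimately show ?thesis
    using fg by (intro that dominant_if_rational_inverse)
qed


section \<open>Rational actions at a fixed parameter\<close>

lemma tensor_slice_regular:
  assumes "function_sheaf X" "openin (ztop X) V" "s \<in> tensor_functions M X U V"
  shows "(\<lambda>x. s (c, x)) \<in> regular X V"
proof -
  obtain n :: nat and a b where "s = (\<lambda>(x, y). \<Sum>k<n. a k x * b k y)"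
    and "\<And>k. k < n \<Longrightarrow> b k \<in> regular X V"
    using assms(3) unfolding tensor_functions_def by blast
  then show ?thesis
    by (simp add: sheaf_sum sheaf_mult sheaf_const assms(1,2))
qed

text \<open>
  Freezing the first variable turns a sum of products \<open>a\<^sub>k(c) b\<^sub>k(x)\<close> into a linear combination of
  the \<open>b\<^sub>k\<close>, so the slice of a basic open set is a non-vanishing locus, or empty.
\<close>

lemma slice_open:
  assumes X: "variety X" and W: "openin (ztop (prod_space M X)) W"
  shows "openin (ztop X) {x. (c, x) \<in> W}"
proof -
  have sh: "function_sheaf X" using X by (simp add: variety_def)
  define B where "B = {{z \<in> U \<times> V. s z \<noteq> 0} | U V s.
      openin (ztop M) U \<and> openin (ztop X) V \<and> s \<in> tensor_functions M X U V}"
  have "generate_topology_on B W"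
    using W by (simp add: prod_space_def Let_def B_def openin_topology_generated_by_iff)
  then show ?thesis
  proof induction
    case Empty
    then show ?case by simp
  next
    case (Int V W)
    moreover have "{x. (c, x) \<in> V \<inter> W} = {x. (c, x) \<in> V} \<inter> {x. (c, x) \<in> W}" by auto
    ultimately show ?case by (simp add: openin_Int)
  next
    case (UN K)
    moreover have "{x. (c, x) \<in> \<Union>K} = \<Union>((\<lambda>W. {x. (c, x) \<in> W}) ` K)" by auto
    ultimately show ?case by (metis (no_types, lifting) imageE openin_Union)
  next
    case (Basis W)
    then obtain U V s where W: "W = {z \<in> U \<times> V. s z \<noteq> 0}" and V: "openin (ztop X) V"
      and s: "s \<in> tensor_functions M X U V"
      unfolding B_def by blast
    show ?case
    proof (cases "c \<in> U")
      case True
      have "openin (ztop X) {x \<in> V. s (c, x) \<noteq> 0}"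
        using variety_nonvanishing_open[OF X V tensor_slice_regular[OF sh V s]] .
      then show ?thesis using True W by simp
    qed (simp add: W)
  qed
qed

lemma prod_space_regular_at:
  assumes "F \<in> regular (prod_space M X) W" "z \<in> W"
  shows "\<exists>N U V. openin (ztop (prod_space M X)) N \<and> z \<in> N \<and> N \<subseteq> W \<inter> (U \<times> V) \<and>
           openin (ztop M) U \<and> openin (ztop X) V \<and>
           (\<exists>s\<in>tensor_functions M X U V. \<exists>t\<in>tensor_functions M X U V.
              \<forall>w\<in>N. t w \<noteq> 0 \<and> F w = s w / t w)"
  using assms by (simp add: prod_space_def Let_def)

lemma slice_regular:
  assumes X: "variety X" and W: "openin (ztop (prod_space M X)) W"
    and F: "F \<in> regular (prod_space M X) W"
  shows "(\<lambda>x. F (c, x)) \<in> regular X {x. (c, x) \<in> W}"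
proof (rule sheaf_glue)
  show sh: "function_sheaf X" using X by (simp add: variety_def)
  show "openin (ztop X) {x. (c, x) \<in> W}" by (rule slice_open[OF X W])
next
  fix x assume "x \<in> {x. (c, x) \<in> W}"
  then have "(c, x) \<in> W" by simp
  from prod_space_regular_at[OF F this] obtain N U V s t
    where N: "openin (ztop (prod_space M X)) N" "(c, x) \<in> N" "N \<subseteq> W \<inter> (U \<times> V)"
    and V: "openin (ztop X) V"
    and s: "s \<in> tensor_functions M X U V" and t: "t \<in> tensor_functions M X U V"
    and F: "\<forall>w\<in>N. t w \<noteq> 0 \<and> F w = s w / t w"
    by metis
  define K where "K = {x. (c, x) \<in> N}"
  have sh: "function_sheaf X" using X by (simp add: variety_def)
  have K: "openin (ztop X) K" unfolding K_def by (rule slice_open[OF X N(1)])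
  have KV: "K \<subseteq> V" using N(3) by (auto simp: K_def)
  have st: "(\<lambda>x. s (c, x)) \<in> regular X K" "(\<lambda>x. t (c, x)) \<in> regular X K"
    using tensor_slice_regular[OF sh V s] tensor_slice_regular[OF sh V t]
    by (auto intro: sheaf_restrict[OF sh V _ K KV])
  have "(\<lambda>x. inverse (t (c, x))) \<in> regular X K"
    by (rule variety_inverse_regular[OF X K st(2)]) (use F in \<open>auto simp: K_def\<close>)
  from sheaf_mult[OF sh K st(1) this] have "(\<lambda>x. F (c, x)) \<in> regular X K"
    by (rule sheaf_cong[OF sh K]) (use F in \<open>auto simp: K_def field_simps\<close>)
  then show "\<exists>K. openin (ztop X) K \<and> x \<in> K \<and> K \<subseteq> {x. (c, x) \<in> W} \<and> (\<lambda>x. F (c, x)) \<in> regular X K"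
    using K N(2,3) by (intro exI[of _ K]) (auto simp: K_def)
qed

lemma partial_morphism_slice:
  assumes X: "variety X" and e: "partial_morphism (prod_space M X) Y e"
  shows "partial_morphism X Y (\<lambda>x. e (c, x))"
  unfolding partial_morphism_def
proof (intro conjI allI impI ballI)
  show "ran (\<lambda>x. e (c, x)) \<subseteq> points Y"
    using e by (auto simp: partial_morphism_def ran_def)
next
  fix V assume V: "openin (ztop Y) V"
  have pre: "preimage (\<lambda>x. e (c, x)) V = {x. (c, x) \<in> preimage e V}"
    by (simp add: preimage_def)
  have o: "openin (ztop (prod_space M X)) (preimage e V)"
    using e V by (simp add: partial_morphism_def)
  then show "openin (ztop X) (preimage (\<lambda>x. e (c, x)) V)"
    unfolding pre by (rule slice_open[OF X])
  fix h assume "h \<in> regular Y V"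
  then have "(\<lambda>z. h (the (e z))) \<in> regular (prod_space M X) (preimage e V)"
    using e V by (simp add: partial_morphism_def)
  from slice_regular[OF X o this]
  show "(\<lambda>x. h (the (e (c, x)))) \<in> regular X (preimage (\<lambda>x. e (c, x)) V)"
    unfolding pre .
qed

text \<open>
  The maps for \<open>c\<close> and \<open>inverse c\<close> are rationally inverse to each other, because both composites agree
  generically with the map for the parameter \<open>1\<close>, which is the identity wherever it is defined.
\<close>

lemma rational_action_dominant:
  assumes X: "variety X" and e: "rational_action X e" and c: "c \<noteq> 0"
  shows "dominant X X (\<lambda>x. e (c, x))"
proof (rule dominant_if_rational_inverse)
  have "partial_morphism (prod_space mult_group X) X e"
    using e unfolding rational_action_def rational_map_def rational_rep_iff by blast
  then show "partial_morphism X X (\<lambda>x. e (c, x))"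
    "partial_morphism X X (\<lambda>x. e (inverse c, x))"
    by (rule partial_morphism_slice[OF X])+
  have one: "rat_eq X f Some" if "rat_eq X f (\<lambda>x. e (1, x))" for f
  proof -
    have *: "e (1, x) = Some x" if "x \<in> dom (\<lambda>x. e (1, x))" for x
      using e that unfolding rational_action_def by auto
    from that obtain W where "open_dense (ztop X) W" "W \<subseteq> dom f \<inter> dom (\<lambda>x. e (1, x))"
      "\<forall>x\<in>W. f x = e (1, x)"
      unfolding rat_eq_def by blast
    moreover from this have "f x = Some x" if "x \<in> W" for x
      using *[of x] that by auto
    ultimately show ?thesis
      unfolding rat_eq_def by (intro exI[of _ W]) auto
  qed
  have mult: "rat_eq X ((\<lambda>x. e (a, x)) \<circ>\<^sub>m (\<lambda>x. e (b, x))) (\<lambda>x. e (a * b, x))"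
    if "a \<noteq> 0" "b \<noteq> 0" for a b
    using e that unfolding rational_action_def by blast
  show "rat_eq X ((\<lambda>x. e (inverse c, x)) \<circ>\<^sub>m (\<lambda>x. e (c, x))) Some"
    "rat_eq X ((\<lambda>x. e (c, x)) \<circ>\<^sub>m (\<lambda>x. e (inverse c, x))) Some"
    using mult[of "inverse c" c] mult[of c "inverse c"] c by (auto intro: one)
qed


section \<open>Maps commuting with a crystal structure\<close>

lemma map_comp_assoc: "(f \<circ>\<^sub>m g) \<circ>\<^sub>m h = f \<circ>\<^sub>m (g \<circ>\<^sub>m h)"
  by (auto simp: map_comp_def fun_eq_iff split: option.splits)

lemma map_comp_Some: "f \<circ>\<^sub>m Some = f" "Some \<circ>\<^sub>m f = f"
  by (auto simp: map_comp_def fun_eq_iff split: option.splits)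

text \<open>
  If \<open>f a = b f\<close> and \<open>g\<close> is inverse to \<open>f\<close>, then \<open>g b = g b f g = g f a g = a g\<close>.
\<close>

lemma rat_eq_inverse_intertwines:
  assumes sh: "function_sheaf X" "function_sheaf Y"
    and d: "dominant X Y f" "dominant Y X g" "dominant X X a" "dominant Y Y b"
    and gf: "rat_eq X (g \<circ>\<^sub>m f) Some" and fg: "rat_eq Y (f \<circ>\<^sub>m g) Some"
    and fa: "rat_eq X (f \<circ>\<^sub>m a) (b \<circ>\<^sub>m f)"
  shows "rat_eq Y (g \<circ>\<^sub>m b) (a \<circ>\<^sub>m g)"
proof -
  note comp = dominant_comp[OF sh(1)] dominant_comp[OF sh(2)]
  have "rat_eq Y ((g \<circ>\<^sub>m b) \<circ>\<^sub>m (f \<circ>\<^sub>m g)) ((g \<circ>\<^sub>m b) \<circ>\<^sub>m Some)"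
    by (rule rat_eq_comp_left[OF fg comp(2)[OF d(1,2)] comp(2)[OF d(2,4)]])
  then have 1: "rat_eq Y (g \<circ>\<^sub>m b) ((g \<circ>\<^sub>m (b \<circ>\<^sub>m f)) \<circ>\<^sub>m g)"
    by (simp add: map_comp_Some map_comp_assoc rat_eq_sym)
  have "rat_eq X (g \<circ>\<^sub>m (f \<circ>\<^sub>m a)) (g \<circ>\<^sub>m (b \<circ>\<^sub>m f))"
    by (rule rat_eq_comp_left[OF fa comp(1)[OF d(1,3)] d(2)])
  from rat_eq_comp_right[OF rat_eq_sym[OF this] d(2)]
  have 2: "rat_eq Y ((g \<circ>\<^sub>m (b \<circ>\<^sub>m f)) \<circ>\<^sub>m g) ((g \<circ>\<^sub>m f) \<circ>\<^sub>m (a \<circ>\<^sub>m g))"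
    by (simp add: map_comp_assoc)
  have "rat_eq Y ((g \<circ>\<^sub>m f) \<circ>\<^sub>m (a \<circ>\<^sub>m g)) (Some \<circ>\<^sub>m (a \<circ>\<^sub>m g))"
    by (rule rat_eq_comp_right[OF gf comp(2)[OF d(3,2)]])
  with 1 2 show ?thesis by (metis map_comp_Some(2) rat_eq_trans)
qed

text \<open>
  Generic commutation with \<open>g\<close> passes from the single maps to their composites, because all maps
  involved are dominant. The path from \<open>x\<close> to \<open>y\<close> thus becomes a single map \<open>E\<close>, and \<open>g\<close> may well be
  undefined at points on the path.
\<close>

lemma orbit_point_by_commuting_map:
  assumes var: "variety (base \<X>)"
    and act: "\<And>i. i \<in> I \<Longrightarrow> rational_action (base \<X>) (action \<X> i)"
    and g: "dominant (base \<X>) (base \<X>) g"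
    and ge: "\<And>i c. i \<in> I \<Longrightarrow> c \<noteq> 0 \<Longrightarrow>
      rat_eq (base \<X>) (g \<circ>\<^sub>m e_pow \<X> i c) (e_pow \<X> i c \<circ>\<^sub>m g)"
    and y: "y \<in> orbit_of I \<X> x" and x: "x \<in> points (base \<X>)"
  shows "\<exists>E. dominant (base \<X>) (base \<X>) E \<and> E x = Some y \<and> rat_eq (base \<X>) (g \<circ>\<^sub>m E) (E \<circ>\<^sub>m g)"
  using y
proof induction
  case start
  let ?id = "Some |` points (base \<X>)"
  have sh: "function_sheaf (base \<X>)" using var by (simp add: variety_def)
  have "dom g \<subseteq> points (base \<X>)"
    using dominant_dom[OF g] by (simp add: open_dense_def openin_subset)
  then have "g x = None" if "x \<notin> points (base \<X>)" for x
    using that by blast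
  then have "g \<circ>\<^sub>m ?id = g"
    by (auto simp: fun_eq_iff map_comp_def restrict_map_def)
  moreover have "ran g \<subseteq> points (base \<X>)"
    using g by (simp add: dominant_def partial_morphism_def)
  then have "?id \<circ>\<^sub>m g = g"
    by (auto simp: fun_eq_iff map_comp_def restrict_map_def ran_def split: option.splits)
  ultimately have "rat_eq (base \<X>) (g \<circ>\<^sub>m ?id) (?id \<circ>\<^sub>m g)"
    using rat_eq_reflexive[OF dominant_dom[OF g]] by simp
  moreover have "?id x = Some x" using x by simp
  ultimately show ?case using dominant_identity[OF sh] by blast
next
  case (step y i c z)
  then obtain E where E: "dominant (base \<X>) (base \<X>) E" "E x = Some y"
    "rat_eq (base \<X>) (g \<circ>\<^sub>m E) (E \<circ>\<^sub>m g)" by blast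
  have e: "dominant (base \<X>) (base \<X>) (e_pow \<X> i c)"
    using rational_action_dominant[OF var act] step.hyps by blast
  have sh: "function_sheaf (base \<X>)" using var by (simp add: variety_def)
  have "rat_eq (base \<X>) (g \<circ>\<^sub>m (e_pow \<X> i c \<circ>\<^sub>m E)) (e_pow \<X> i c \<circ>\<^sub>m (g \<circ>\<^sub>m E))"
    using rat_eq_comp_right[OF ge E(1)] step.hyps by (simp add: map_comp_assoc)
  moreover have "rat_eq (base \<X>) (e_pow \<X> i c \<circ>\<^sub>m (g \<circ>\<^sub>m E)) ((e_pow \<X> i c \<circ>\<^sub>m E) \<circ>\<^sub>m g)"
    using rat_eq_comp_left[OF E(3) dominant_comp[OF sh g E(1)] e] by (simp add: map_comp_assoc)
  ultimately have "rat_eq (base \<X>) (g \<circ>\<^sub>m (e_pow \<X> i c \<circ>\<^sub>m E)) ((e_pow \<X> i c \<circ>\<^sub>m E) \<circ>\<^sub>m g)"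
    by (rule rat_eq_trans)
  moreover have "(e_pow \<X> i c \<circ>\<^sub>m E) x = Some z" using E(2) step.hyps by simp
  ultimately show ?case using dominant_comp[OF sh e E(1)] by blast
qed

theorem lemma3p2:
  fixes I :: "'i set" and A :: "'i \<Rightarrow> 'i \<Rightarrow> int"
    and X1 :: "('i, 'a) crystal" and X2 :: "('i, 'b) crystal"
    and \<Omega>1 :: "'a set" and \<phi> \<phi>' :: "'a \<rightharpoonup> 'b" and p1 :: 'a
  assumes "symmetrizable_gcm I A"
    and "geometric_crystal I A X1" and "geometric_crystal I A X2"
    and "prehomogeneous I X1"
    and "open_dense (ztop (base X1)) \<Omega>1" and "is_orbit I X1 \<Omega>1"
    and "crystal_isomorphism I X1 X2 \<phi>" and "crystal_isomorphism I X1 X2 \<phi>'"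
    and "p1 \<in> \<Omega>1" and "p1 \<in> dom \<phi>" and "p1 \<in> dom \<phi>'"
    and "\<phi> p1 = \<phi>' p1"
  shows "rat_eq (base X1) \<phi> \<phi>'"
proof -
  let ?X = "base X1" and ?Y = "base X2"
  have var: "variety ?X" "variety ?Y"
    using assms(2,3) by (auto simp: geometric_crystal_def)
  then have sh: "function_sheaf ?X" "function_sheaf ?Y" by (auto simp: variety_def)
  have bir: "birational_map ?X ?Y \<phi>" "birational_map ?X ?Y \<phi>'"
    using assms(7,8) by (auto simp: crystal_isomorphism_def)
  have \<phi>: "dominant ?X ?Y \<phi>" using birational_map_dominant_inverse[OF bir(1)] by metis
  obtain \<psi> where \<phi>': "dominant ?X ?Y \<phi>'" and \<psi>: "dominant ?Y ?X \<psi>"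
    and inv: "\<And>x y. \<phi>' x = Some y \<longleftrightarrow> \<psi> y = Some x"
      "rat_eq ?X (\<psi> \<circ>\<^sub>m \<phi>') Some" "rat_eq ?Y (\<phi>' \<circ>\<^sub>m \<psi>) Some"
    using birational_map_dominant_inverse[OF bir(2)] by metis
  define g where "g = \<psi> \<circ>\<^sub>m \<phi>"
  have g: "dominant ?X ?X g" unfolding g_def by (rule dominant_comp[OF sh(1) \<psi> \<phi>])
  have g_fix: "g x = Some x \<longleftrightarrow> x \<in> dom \<phi> \<inter> dom \<phi>' \<and> \<phi> x = \<phi>' x" for x
    unfolding g_def map_comp_Some_iff inv(1)[symmetric] by auto
  have ge: "rat_eq ?X (g \<circ>\<^sub>m e_pow X1 i c) (e_pow X1 i c \<circ>\<^sub>m g)" if ic: "i \<in> I" "c \<noteq> 0" for i c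
  proof -
    have act: "rational_action ?X (action X1 i)" "rational_action ?Y (action X2 i)"
      using assms(2,3) ic(1) by (auto simp: geometric_crystal_def)
    have e1: "dominant ?X ?X (e_pow X1 i c)"
      by (rule rational_action_dominant[OF var(1) act(1) ic(2)])
    have e2: "dominant ?Y ?Y (e_pow X2 i c)"
      by (rule rational_action_dominant[OF var(2) act(2) ic(2)])
    have c: "rat_eq ?X (\<phi> \<circ>\<^sub>m e_pow X1 i c) (e_pow X2 i c \<circ>\<^sub>m \<phi>)"
      "rat_eq ?X (\<phi>' \<circ>\<^sub>m e_pow X1 i c) (e_pow X2 i c \<circ>\<^sub>m \<phi>')"
      using assms(7,8) ic by (auto simp: crystal_isomorphism_def)
    have "rat_eq ?X (\<psi> \<circ>\<^sub>m (\<phi> \<circ>\<^sub>m e_pow X1 i c)) (\<psi> \<circ>\<^sub>m (e_pow X2 i c \<circ>\<^sub>m \<phi>))"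
      by (rule rat_eq_comp_left[OF c(1) dominant_comp[OF sh(1) \<phi> e1] \<psi>])
    moreover have "rat_eq ?X ((\<psi> \<circ>\<^sub>m e_pow X2 i c) \<circ>\<^sub>m \<phi>) ((e_pow X1 i c \<circ>\<^sub>m \<psi>) \<circ>\<^sub>m \<phi>)"
      by (rule rat_eq_comp_right[OF rat_eq_inverse_intertwines[OF sh \<phi>' \<psi> e1 e2 inv(2,3) c(2)] \<phi>])
    ultimately show ?thesis
      unfolding g_def map_comp_assoc by (rule rat_eq_trans)
  qed
  have act1: "rational_action ?X (action X1 i)" if "i \<in> I" for i
    using assms(2) that by (simp add: geometric_crystal_def)
  have p1: "p1 \<in> points ?X" "g p1 = Some p1"
    using openin_subset[of "ztop ?X" \<Omega>1] assms(5,9-12) by (auto simp: open_dense_def g_fix)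
  have fixed: "g q = Some q" if q: "q \<in> \<Omega>1 \<inter> dom g" for q
  proof -
    have "q \<in> orbit_of I X1 p1"
      using assms(6,9) q by (auto simp: is_orbit_def)
    then obtain E where E: "dominant ?X ?X E" "E p1 = Some q" "rat_eq ?X (g \<circ>\<^sub>m E) (E \<circ>\<^sub>m g)"
      using orbit_point_by_commuting_map[OF var(1) act1 g ge _ p1(1)] by blast
    (* The values at p1 are g(q) and E(p1) = q. *)
    have "(g \<circ>\<^sub>m E) p1 = (E \<circ>\<^sub>m g) p1"
    proof (rule rat_eq_at_common_point[OF var(1) var(1) _ _ E(3)])
      show "partial_morphism ?X ?X (g \<circ>\<^sub>m E)" "partial_morphism ?X ?X (E \<circ>\<^sub>m g)"
        using dominant_comp[OF sh(1)] g E(1) by (auto simp: dominant_def)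
      show "p1 \<in> dom (g \<circ>\<^sub>m E)" "p1 \<in> dom (E \<circ>\<^sub>m g)"
        using E(2) p1(2) q by auto
    qed
    then show ?thesis using E(2) p1(2) by simp
  qed
  have "open_dense (ztop ?X) (\<Omega>1 \<inter> dom g)"
    by (rule open_dense_Int[OF assms(5) dominant_dom[OF g]])
  then show ?thesis
    unfolding rat_eq_def using fixed g_fix by (intro exI[of _ "\<Omega>1 \<inter> dom g"]) blast
qed

end
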